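(* Let $R>0$ and let $q_1(x,u),q_2(x,u)$ be real-valued $C^\infty$ functions on $\mathbb{R}^{n+1}\times\mathbb{R}$ supported in $\{|x|\le R\}\times\mathbb{R}$. For $i=1,2$, real-valued $\varphi,\chi\in C_0^\infty(\mathbb{R})$, $\theta,\omega\in\mathbb{S}^{n-1}$, $V=(\pm1,\theta)$, $W=(-1,\omega)$, $A,B\in\mathbb{R}$ and sufficiently small $h>0$, let $u_i(h,V,W,x)$ be the oscillatory solution on $[T_0,T]\times\mathbb{R}^n$ (described in the context) of $$\square u=q_i(x,u)\bigl((\partial_{x_0}u)^2-|\nabla_{x'}u|^2\bigr)$$ which equals $$u_{inc}(h,V,W,x)=\varphi_V(x)+h\,\chi_W(x)\Bigl(A\cos\bigl(\tfrac1h\langle x,W\rangle_M\bigr)+B\sin\bigl(\tfrac1h\langle x,W\rangle_M\bigr)\Bigr)$$ for $x_0\ll0$. If $T'<T$ are large enough (depending on $R$), then the data $u(h,V,W,x)|_{\{x_0=T'\}}$ determine $q(x,u)$ uniquely; that is, if $u_1(h,V,W,x)|_{\{x_0=T'\}}=u_2(h,V,W,x)|_{\{x_0=T'\}}$ for all such $\varphi,\chi,V,W,A,B$ and all sufficiently small $h$, then $q_1=q_2$.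
   Context: Points of $\mathbb{R}^{n+1}$ are $x=(x_0,x')$, $x'=(x_1,\dots,x_n)$, with $x_0$ the time variable; $\square=-\partial_{x_0}^2+\sum_{j=1}^n\partial_{x_j}^2$; $\nabla_{x'}=(\partial_{x_1},\dots,\partial_{x_n})$. The Minkowski product is $\langle X,Y\rangle_M=-X_0Y_0+\sum_{j=1}^nX_jY_j$. For $V=(\pm1,\theta)$ put $\widetilde V=(\mp1,\theta)$; for $W=(-1,\omega)$, $\langle x,W\rangle_M=x_0+\langle x',\omega\rangle$ and $\widetilde W=(1,\omega)$. For $\varphi\in C^\infty(\mathbb{R})$, $\varphi_V(x)=\varphi(\langle x,V\rangle_M)$, $\varphi_V'(x)=\varphi'(\langle x,V\rangle_M)$; similarly $\chi_W$. "$x_0\ll0$" means $x_0$ sufficiently negative, so that $q$ vanishes there; the interval $[T_0,T]$ begins at such a $T_0$. The oscillatory solution: for $q$ smooth and supported in $\{|x|\le R\}\times\mathbb{R}$, any $N\in\mathbb{N}$ and any interval $[T_0,T]$, for small $h$ there is a unique solution $u(h,V,W,x)$ of $\square u=q(x,u)((\partial_{x_0}u)^2-|\nabla_{x'}u|^2)$ on $[T_0,T]\times\mathbb{R}^n$ equal to $u_{inc}$ for $x_0\ll0$ and having an expansion $$u=\varphi_V+h\sum_{p=0}^Nh^p\sum_{m=-N}^Ne^{\frac{im}{h}\langle x,W\rangle_M}A_{m,p}(V,W,x)+h^{N+1}\mathcal{E}_N(h,V,W,x),$$ with $A_{m,p}\in C^\infty$ independent of $h$, $\overline{A_{m,p}}=A_{-m,p}$,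 and, for $x_0\ll0$, $A_{0,p}=0$, $A_{1,0}=\frac12\chi_W(A-iB)$, $A_{m,0}=0$ for $m\ge2$, $A_{m,p}=0$ for $p\ge1$. The coefficient $A_{1,0}$ satisfies $(\partial_{x_0}-\omega\cdot\nabla_{x'})A_{1,0}=\langle q(x,\varphi_V)\varphi_V'\widetilde V,\widetilde W\rangle_M\,A_{1,0}$, and $\mathcal{E}_N$ is bounded in $L^2(\mathbb{R}^n)$ and $L^\infty(\mathbb{R}^n)$ uniformly in $h$ and in $x_0$ on compact subintervals. *)

theory Defs
  imports "HOL-Analysis.Analysis"
begin

text \<open>
  Space-time $\mathbb{R}^{n+1}$ is \<open>real \<times> real ^ 'n\<close>: the first component is the time
  variable $x_0$, the second one is $x'$. The product norm is the Euclidean norm.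
\<close>

type_synonym 'n spacetime = "real \<times> (real ^ 'n)"

definition slab :: "real \<Rightarrow> real \<Rightarrow> 'n::finite spacetime set" where
  "slab T0 T = {T0..T} \<times> UNIV"

definition mink :: "'n::finite spacetime \<Rightarrow> 'n spacetime \<Rightarrow> real" where
  "mink X Y = - (fst X * fst Y) + (\<Sum>j\<in>UNIV. snd X $ j * snd Y $ j)"

definition time_flip :: "'n::finite spacetime \<Rightarrow> 'n spacetime" where
  "time_flip V = (- fst V, snd V)"

text \<open>
  Derivatives are taken within \<open>S\<close>, so that they are one-sided at the two boundary
  hyperplanes of a slab. They are uniquely determined for the sets used here (the whole space,
  and slabs of positive height).
\<close>

definition pderiv_within ::
    "'a::euclidean_space set \<Rightarrow> 'a \<Rightarrow> ('a \<Rightarrow> 'b::real_normed_vector) \<Rightarrow> 'a \<Rightarrow> 'b" where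
  "pderiv_within S v f x = frechet_derivative f (at x within S) v"

primrec Ck_on ::
    "nat \<Rightarrow> 'a::euclidean_space set \<Rightarrow> ('a \<Rightarrow> 'b::real_normed_vector) \<Rightarrow> bool" where
  "Ck_on 0 S f \<longleftrightarrow> continuous_on S f"
| "Ck_on (Suc k) S f \<longleftrightarrow> f differentiable_on S \<and> (\<forall>v. Ck_on k S (pderiv_within S v f))"

definition smooth_on ::
    "'a::euclidean_space set \<Rightarrow> ('a \<Rightarrow> 'b::real_normed_vector) \<Rightarrow> bool" where
  "smooth_on S f \<longleftrightarrow> (\<forall>k. Ck_on k S f)"

definition test_function :: "(real \<Rightarrow> real) \<Rightarrow> bool" where
  "test_function f \<longleftrightarrow> smooth_on UNIV f \<and> compact (closure {s. f s \<noteq> 0})"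

definition dt :: "'n::finite spacetime set \<Rightarrow> ('n spacetime \<Rightarrow> 'b::real_normed_vector)
    \<Rightarrow> 'n spacetime \<Rightarrow> 'b" where
  "dt S = pderiv_within S (1, 0)"

definition dx :: "'n::finite spacetime set \<Rightarrow> 'n \<Rightarrow> ('n spacetime \<Rightarrow> 'b::real_normed_vector)
    \<Rightarrow> 'n spacetime \<Rightarrow> 'b" where
  "dx S j = pderiv_within S (0, axis j 1)"

definition box_op :: "'n::finite spacetime set \<Rightarrow> ('n spacetime \<Rightarrow> real)
    \<Rightarrow> 'n spacetime \<Rightarrow> real" where
  "box_op S u x = - dt S (dt S u) x + (\<Sum>j\<in>UNIV. dx S j (dx S j u) x)"

definition solves_on :: "'n::finite spacetime set \<Rightarrow> ('n spacetime \<Rightarrow> real \<Rightarrow> real)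
    \<Rightarrow> ('n spacetime \<Rightarrow> real) \<Rightarrow> bool" where
  "solves_on S q u \<longleftrightarrow>
     (\<forall>x\<in>S. box_op S u x = q x (u x) * ((dt S u x)\<^sup>2 - (\<Sum>j\<in>UNIV. (dx S j u x)\<^sup>2)))"

text \<open>
  The set in which $q$ is supported is closed, so it suffices that $q$ vanishes outside it.
\<close>

definition admissible :: "real \<Rightarrow> ('n::finite spacetime \<Rightarrow> real \<Rightarrow> real) \<Rightarrow> bool" where
  "admissible R q \<longleftrightarrow>
     smooth_on UNIV (\<lambda>(x, s). q x s) \<and> (\<forall>x s. q x s \<noteq> 0 \<longrightarrow> norm x \<le> R)"

definition V_directions :: "'n::finite spacetime set" where
  "V_directions = {1, -1} \<times> sphere 0 1"

definition W_directions :: "'n::finite spacetime set" where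
  "W_directions = {-1} \<times> sphere 0 1"

text \<open>
  The cut-off $\chi$ is called \<open>\<psi>\<close>, since the letter chi is the binder for vectors in the library.
\<close>

definition u_inc :: "(real \<Rightarrow> real) \<Rightarrow> (real \<Rightarrow> real) \<Rightarrow> 'n::finite spacetime \<Rightarrow> 'n spacetime
    \<Rightarrow> real \<Rightarrow> real \<Rightarrow> real \<Rightarrow> 'n spacetime \<Rightarrow> real" where
  "u_inc \<phi> \<psi> V W A B h x =
     \<phi> (mink x V) + h * \<psi> (mink x W) * (A * cos (mink x W / h) + B * sin (mink x W / h))"

definition expansion :: "nat \<Rightarrow> (real \<Rightarrow> real) \<Rightarrow> 'n::finite spacetime \<Rightarrow> 'n spacetime
    \<Rightarrow> (int \<Rightarrow> nat \<Rightarrow> 'n spacetime \<Rightarrow> complex) \<Rightarrow> (real \<Rightarrow> 'n spacetime \<Rightarrow> complex)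
    \<Rightarrow> real \<Rightarrow> 'n spacetime \<Rightarrow> complex" where
  "expansion N \<phi> V W a E h x =
     of_real (\<phi> (mink x V))
     + of_real h * (\<Sum>p=0..N. of_real h ^ p *
         (\<Sum>m=-int N..int N. cis (of_int m / h * mink x W) * a m p x))
     + of_real h ^ (N + 1) * E h x"

text \<open>
  The conditions on the coefficients $A_{m,p}$ (here \<open>a m p\<close>). The number \<open>t1\<close> makes
  ``$x_0 \ll 0$'' explicit: it stands for $x_0 \le t_1$.
\<close>

definition amplitudes :: "('n::finite spacetime \<Rightarrow> real \<Rightarrow> real) \<Rightarrow> real \<Rightarrow> real \<Rightarrow> real
    \<Rightarrow> (real \<Rightarrow> real) \<Rightarrow> (real \<Rightarrow> real) \<Rightarrow> 'n spacetime \<Rightarrow> 'n spacetime \<Rightarrow> real \<Rightarrow> real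
    \<Rightarrow> (int \<Rightarrow> nat \<Rightarrow> 'n spacetime \<Rightarrow> complex) \<Rightarrow> bool" where
  "amplitudes q T0 t1 T \<phi> \<psi> V W A B a \<longleftrightarrow>
     (\<forall>m p. smooth_on (slab T0 T) (a m p)) \<and>
     (\<forall>m p. \<forall>x\<in>slab T0 T. cnj (a m p x) = a (- m) p x) \<and>
     (\<forall>x\<in>slab T0 T. fst x \<le> t1 \<longrightarrow>
        (\<forall>p. a 0 p x = 0) \<and>
        a 1 0 x = of_real (\<psi> (mink x W)) / 2 * (of_real A - \<i> * of_real B) \<and>
        (\<forall>m\<ge>2. a m 0 x = 0) \<and>
        (\<forall>m. \<forall>p\<ge>1. a m p x = 0)) \<and>
     (\<forall>x\<in>slab T0 T.
        dt (slab T0 T) (a 1 0) x - (\<Sum>j\<in>UNIV. (snd W $ j) *\<^sub>R dx (slab T0 T) j (a 1 0) x)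
        = of_real (mink ((q x (\<phi> (mink x V)) * deriv \<phi> (mink x V)) *\<^sub>R time_flip V)
                        (time_flip W)) * a 1 0 x)"

definition L2_Linf_bound :: "real \<Rightarrow> (real ^ 'n::finite \<Rightarrow> complex) \<Rightarrow> bool" where
  "L2_Linf_bound C f \<longleftrightarrow>
     f \<in> borel_measurable lborel \<and>
     (\<integral>\<^sup>+ y. ennreal ((norm (f y))\<^sup>2) \<partial>lborel) \<le> ennreal (C\<^sup>2) \<and>
     (AE y in lborel. norm (f y) \<le> C)"

text \<open>
  A family \<open>u h\<close> of functions, of which only small \<open>h > 0\<close> matter. The order \<open>N\<close> starts at 1:
  for \<open>N = 0\<close> the incident term $h A_{1,0} e^{i \langle x, W\rangle_M / h}$ would be missing from
  the sum and belong to the remainder, but it is a plane wave, which is not in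
  $L^2(\mathbb{R}^n)$ for $n \ge 2$.
\<close>

definition oscillatory_solution :: "('n::finite spacetime \<Rightarrow> real \<Rightarrow> real) \<Rightarrow> real \<Rightarrow> real
    \<Rightarrow> (real \<Rightarrow> real) \<Rightarrow> (real \<Rightarrow> real) \<Rightarrow> 'n spacetime \<Rightarrow> 'n spacetime \<Rightarrow> real \<Rightarrow> real
    \<Rightarrow> (real \<Rightarrow> 'n spacetime \<Rightarrow> real) \<Rightarrow> bool" where
  "oscillatory_solution q T0 T \<phi> \<psi> V W A B u \<longleftrightarrow>
     (\<exists>t1>T0.
        (\<forall>\<^sub>F h in at_right 0.
           smooth_on (slab T0 T) (u h) \<and>
           solves_on (slab T0 T) q (u h) \<and>
           (\<forall>x\<in>slab T0 T. fst x \<le> t1 \<longrightarrow> u h x = u_inc \<phi> \<psi> V W A B h x)) \<and>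
        (\<forall>N\<ge>1. \<exists>a E.
           amplitudes q T0 t1 T \<phi> \<psi> V W A B a \<and>
           (\<forall>\<^sub>F h in at_right 0. \<forall>x\<in>slab T0 T.
              of_real (u h x) = expansion N \<phi> V W a E h x) \<and>
           (\<forall>c d. {c..d} \<subseteq> {T0..T} \<longrightarrow>
              (\<exists>C. \<forall>\<^sub>F h in at_right 0. \<forall>t\<in>{c..d}. L2_Linf_bound C (\<lambda>y. E h (t, y))))))"

type_synonym 'n solution_family =
  "(real \<Rightarrow> real) \<Rightarrow> (real \<Rightarrow> real) \<Rightarrow> 'n spacetime \<Rightarrow> 'n spacetime \<Rightarrow> real \<Rightarrow> real
    \<Rightarrow> real \<Rightarrow> 'n spacetime \<Rightarrow> real"

definition oscillatory_family :: "('n::finite spacetime \<Rightarrow> real \<Rightarrow> real) \<Rightarrow> real \<Rightarrow> real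
    \<Rightarrow> 'n solution_family \<Rightarrow> bool" where
  "oscillatory_family q T0 T u \<longleftrightarrow>
     (\<forall>\<phi> \<psi>. \<forall>V\<in>V_directions. \<forall>W\<in>W_directions. \<forall>A B.
        test_function \<phi> \<longrightarrow> test_function \<psi> \<longrightarrow>
        oscillatory_solution q T0 T \<phi> \<psi> V W A B (u \<phi> \<psi> V W A B))"

definition same_data_at :: "real \<Rightarrow> 'n::finite solution_family \<Rightarrow> 'n solution_family \<Rightarrow> bool" where
  "same_data_at T' u1 u2 \<longleftrightarrow>
     (\<forall>\<phi> \<psi>. \<forall>V\<in>V_directions. \<forall>W\<in>W_directions. \<forall>A B.
        test_function \<phi> \<longrightarrow> test_function \<psi> \<longrightarrow>
        (\<forall>\<^sub>F h in at_right 0. \<forall>y. u1 \<phi> \<psi> V W A B h (T', y) = u2 \<phi> \<psi> V W A B h (T', y)))"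

end

theory Submission
  imports Defs
begin

text \<open>
  Fix a unit vector \<open>\<omega>\<close>, and take \<open>V = (1, \<omega>)\<close> and \<open>W = (-1, \<omega>)\<close>. As \<open>h \<rightarrow> 0\<close> along sequences with
  prescribed phase, the data at time \<open>T'\<close> determine the leading amplitude \<open>A_{1,0}\<close> wherever the phase
  \<open>\<langle>x, W\<rangle>\<close> does not vanish. By the transport equation it is \<open>exp (2 \<integral> q \<phi>')\<close> times its initial value,
  with the integral along the ray \<open>s \<mapsto> (s, y - s \<omega>)\<close>, on which \<open>\<langle>x, V\<rangle> = \<omega> \<bullet> y - 2 s\<close> is not constant.
  If \<open>\<phi>\<close> approximates a step of height \<open>u\<close> at the parameter value of a point \<open>x\<close> of the ray, then
  \<open>\<integral> q \<phi>'\<close> tends to a multiple of the integral of \<open>q(x, \<cdot>)\<close> over \<open>[0, u]\<close>. As \<open>u\<close> is arbitrary, this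
  determines \<open>q(x, \<cdot>)\<close>. Points where the phase vanishes are reached by continuity.
\<close>

subsection \<open>Smooth steps on the real line\<close>

text \<open>\<open>Ck_on\<close> asks for the derivative in every direction v. On the line this is v
  times the ordinary derivative, hence the arbitrary factor c in the second premise;
  \<open>Ck_on_cmult\<close> disposes of it in \<open>Ck_on_SucI\<close>.\<close>

lemma Ck_on_Suc_realI:
  fixes f :: "real \<Rightarrow> real"
  assumes "\<And>x. (f has_real_derivative f' x) (at x)" and "\<And>c. Ck_on k UNIV (\<lambda>x. c * f' x)"
  shows "Ck_on (Suc k) UNIV f"
proof -
  have "pderiv_within UNIV v f = (\<lambda>x. v * f' x)" for v
  proof
    fix x
    have "(f has_derivative (*) (f' x)) (at x)"
      using assms(1) by (simp add: has_field_derivative_def)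
    then show "pderiv_within UNIV v f x = v * f' x"
      by (simp add: pderiv_within_def frechet_derivative_at[symmetric] mult.commute)
  qed
  moreover have "f differentiable_on UNIV"
    using assms(1) by (auto simp: differentiable_on_def real_differentiable_def)
  ultimately show ?thesis
    using assms(2) by simp
qed

lemma Ck_on_Suc_realD:
  fixes f :: "real \<Rightarrow> real"
  assumes "Ck_on (Suc k) UNIV f"
  shows "(f has_real_derivative deriv f x) (at x)" and "Ck_on k UNIV (deriv f)"
proof -
  have d: "(f has_real_derivative deriv f x) (at x)" for x
    using assms by (simp add: differentiable_on_def DERIV_deriv_iff_real_differentiable)
  show "(f has_real_derivative deriv f x) (at x)"
    by (rule d)
  have "pderiv_within UNIV 1 f x = deriv f x" for x
  proof -
    have "(f has_derivative (*) (deriv f x)) (at x)"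
      using d by (simp add: has_field_derivative_def)
    then show ?thesis
      by (simp add: pderiv_within_def frechet_derivative_at[symmetric])
  qed
  then have "pderiv_within UNIV 1 f = deriv f"
    by blast
  then show "Ck_on k UNIV (deriv f)"
    using assms by (metis Ck_on.simps(2))
qed

lemma Ck_on_SucD:
  fixes f :: "real \<Rightarrow> real"
  shows "Ck_on (Suc k) UNIV f \<Longrightarrow> Ck_on k UNIV f"
proof (induction k arbitrary: f)
  case 0
  then show ?case by (simp add: differentiable_imp_continuous_on)
next
  case (Suc k)
  then show ?case by (metis Ck_on.simps(2))
qed

lemma Ck_on_cmult:
  fixes f :: "real \<Rightarrow> real"
  shows "Ck_on k UNIV f \<Longrightarrow> Ck_on k UNIV (\<lambda>x. c * f x)"
proof (induction k arbitrary: f c)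
  case 0
  then show ?case by (auto intro: continuous_intros)
next
  case (Suc k)
  note D = Ck_on_Suc_realD[OF Suc.prems]
  show ?case
  proof (rule Ck_on_Suc_realI)
    show "((\<lambda>x. c * f x) has_real_derivative c * deriv f x) (at x)" for x
      by (rule DERIV_cmult[OF D(1)])
    show "Ck_on k UNIV (\<lambda>x. c' * (c * deriv f x))" for c'
      using Suc.IH[OF D(2), of "c' * c"] by (simp add: mult.assoc)
  qed
qed

lemma Ck_on_SucI:
  fixes f :: "real \<Rightarrow> real"
  assumes "\<And>x. (f has_real_derivative f' x) (at x)" and "Ck_on k UNIV f'"
  shows "Ck_on (Suc k) UNIV f"
  using assms by (intro Ck_on_Suc_realI[of f f'] Ck_on_cmult)

lemma Ck_on_add:
  fixes f g :: "real \<Rightarrow> real"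
  shows "Ck_on k UNIV f \<Longrightarrow> Ck_on k UNIV g \<Longrightarrow> Ck_on k UNIV (\<lambda>x. f x + g x)"
proof (induction k arbitrary: f g)
  case 0
  then show ?case by (auto intro: continuous_intros)
next
  case (Suc k)
  note D = Ck_on_Suc_realD[OF Suc.prems(1)] Ck_on_Suc_realD[OF Suc.prems(2)]
  show ?case
    by (rule Ck_on_SucI[OF DERIV_add[OF D(1,3)] Suc.IH[OF D(2,4)]])
qed

lemma Ck_on_mult:
  fixes f g :: "real \<Rightarrow> real"
  shows "Ck_on k UNIV f \<Longrightarrow> Ck_on k UNIV g \<Longrightarrow> Ck_on k UNIV (\<lambda>x. f x * g x)"
proof (induction k arbitrary: f g)
  case 0
  then show ?case by (auto intro: continuous_intros)
next
  case (Suc k)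
  note D = Ck_on_Suc_realD[OF Suc.prems(1)] Ck_on_Suc_realD[OF Suc.prems(2)]
  \<comment> \<open>The product rule leaves one factor undifferentiated, so both factors are also
    needed at order k.\<close>
  note L = Ck_on_SucD[OF Suc.prems(1)] Ck_on_SucD[OF Suc.prems(2)]
  show ?case
    by (rule Ck_on_SucI[OF DERIV_mult[OF D(1,3)]
          Ck_on_add[OF Suc.IH[OF D(2) L(2)] Suc.IH[OF D(4) L(1)]]])
qed

lemma Ck_on_affine:
  fixes f :: "real \<Rightarrow> real"
  shows "Ck_on k UNIV f \<Longrightarrow> Ck_on k UNIV (\<lambda>x. f (c * x + d))"
proof (induction k arbitrary: f)
  case 0
  then show ?case by (auto intro!: continuous_intros intro: continuous_on_compose2)
next
  case (Suc k)
  note D = Ck_on_Suc_realD[OF Suc.prems(1)]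
  show ?case
  proof (rule Ck_on_SucI)
    show "((\<lambda>x. f (c * x + d)) has_real_derivative c * deriv f (c * x + d)) (at x)" for x
      by (rule DERIV_cong, rule DERIV_chain2[OF D(1)]) (rule derivative_eq_intros refl | simp)+
    show "Ck_on k UNIV (\<lambda>x. c * deriv f (c * x + d))"
      by (rule Ck_on_cmult[OF Suc.IH[OF D(2)]])
  qed
qed

section \<open>A flat function, a bump and a smooth step\<close>

text \<open>Differentiating exp (-1/x) produces powers of 1/x. With these factors included, the
  derivative of each member is a combination of two others, so smoothness follows by an induction
  with m arbitrary.\<close>

definition flat :: "nat \<Rightarrow> real \<Rightarrow> real" where
  "flat m x = (if x > 0 then (1 / x) ^ m * exp (- (1 / x)) else 0)"

lemma flat_tendsto_0: "(flat m \<longlongrightarrow> 0) (at 0)"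
proof -
  have "((\<lambda>x::real. x ^ m / exp x) \<longlongrightarrow> 0) at_top"
    by (rule tendsto_power_div_exp_0)
  then have "((\<lambda>x::real. (inverse x) ^ m / exp (inverse x)) \<longlongrightarrow> 0) (at_right 0)"
    by (rule filterlim_compose[OF _ filterlim_inverse_at_top_right])
  moreover have "\<forall>\<^sub>F x in at_right 0. (inverse x) ^ m / exp (inverse x) = flat m x"
    by (auto simp: eventually_at_filter flat_def exp_minus field_simps)
  ultimately have "(flat m \<longlongrightarrow> 0) (at_right 0)"
    by (rule Lim_transform_eventually)
  moreover have "(flat m \<longlongrightarrow> 0) (at_left 0)"
    by (rule tendsto_eventually) (auto simp: eventually_at_filter flat_def)
  ultimately show ?thesis
    by (simp add: filterlim_split_at)
qed

lemma flat_has_derivative: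
  "(flat m has_real_derivative - real m * flat (Suc m) x + flat (Suc (Suc m)) x) (at x)"
proof -
  consider "x > 0" | "x = 0" | "x < 0" by linarith
  then show ?thesis
  proof cases
    case 1
    have "((\<lambda>x. (1 / x) ^ m * exp (- (1 / x))) has_real_derivative
        - real m * flat (Suc m) x + flat (Suc (Suc m)) x) (at x)"
      using 1 by (auto intro!: derivative_eq_intros
          simp: flat_def field_simps power2_eq_square power_Suc[symmetric] simp del: power_Suc)
        (cases m; auto simp: field_simps)
    then show ?thesis
      by (rule has_field_derivative_transform_within_open[where S = "{0<..}"])
        (use 1 in \<open>auto simp: flat_def\<close>)
  next
    case 2
    \<comment> \<open>The difference quotient of \<open>flat m\<close> at 0 is
      \<open>flat (Suc m)\<close>, whose limit is already known.\<close>
    have "((\<lambda>y. (flat m y - flat m 0) / (y - 0)) \<longlongrightarrow> 0) (at 0)"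
      by (rule Lim_transform_eventually[OF flat_tendsto_0[of "Suc m"]])
        (auto simp: eventually_at_filter flat_def)
    then show ?thesis
      using 2 by (simp add: has_field_derivative_iff flat_def[of _ 0])
  next
    case 3
    have "((\<lambda>x. 0) has_real_derivative
        - real m * flat (Suc m) x + flat (Suc (Suc m)) x) (at x)"
      using 3 by (simp add: flat_def)
    then show ?thesis
      by (rule has_field_derivative_transform_within_open[where S = "{..<0}"])
        (use 3 in \<open>auto simp: flat_def\<close>)
  qed
qed

lemma Ck_on_flat: "Ck_on k UNIV (flat m)"
proof (induction k arbitrary: m)
  case 0
  have "isCont (flat m) x" for x
    by (rule DERIV_isCont[OF flat_has_derivative])
  then show ?case
    by (simp add: continuous_on_eq_continuous_at)
next
  case (Suc k)
  show ?case
    by (rule Ck_on_SucI[OF flat_has_derivative Ck_on_add[OF Ck_on_cmult[OF Suc] Suc]])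
qed

definition bump :: "real \<Rightarrow> real" where
  "bump x = flat 0 x * flat 0 (1 - x)"

lemma bump_nonneg: "bump x \<ge> 0"
  by (simp add: bump_def flat_def)

lemma bump_pos: "0 < x \<Longrightarrow> x < 1 \<Longrightarrow> bump x > 0"
  by (simp add: bump_def flat_def)

lemma bump_outside: "x \<le> 0 \<or> x \<ge> 1 \<Longrightarrow> bump x = 0"
  by (auto simp: bump_def flat_def)

lemma Ck_on_bump: "Ck_on k UNIV bump"
  using Ck_on_mult[OF Ck_on_flat[of k 0] Ck_on_affine[OF Ck_on_flat[of k 0], of "-1" 1]]
  by (simp add: bump_def[abs_def])

lemma continuous_bump: "continuous_on S bump"
  using Ck_on_bump[of 0] continuous_on_subset by auto

lemma test_functionI:
  assumes "\<And>k. Ck_on k UNIV f" and "\<And>s. f s \<noteq> 0 \<Longrightarrow> \<bar>s\<bar> \<le> M"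
  shows "test_function f"
  using assms by (auto simp: test_function_def smooth_on_def compact_closure intro!: boundedI)

lemma test_function_bump: "test_function (\<lambda>t. bump (t - d))"
proof (rule test_functionI[where M = "\<bar>d\<bar> + 1"])
  show "Ck_on k UNIV (\<lambda>t. bump (t - d))" for k
    using Ck_on_affine[OF Ck_on_bump, of k 1 "- d"] by simp
  show "bump (s - d) \<noteq> 0 \<Longrightarrow> \<bar>s\<bar> \<le> \<bar>d\<bar> + 1" for s
    using bump_outside[of "s - d"] by linarith
qed

text \<open>The step is an antiderivative of \<open>bump\<close>, shifted and scaled to rise from 0
  to 1. Its derivative is a positive multiple of \<open>bump\<close>, which gives its sign and
  support.\<close>

lemma smooth_step_exists:
  obtains \<eta> \<eta>' :: "real \<Rightarrow> real"
  where "\<And>x. (\<eta> has_real_derivative \<eta>' x) (at x)" and "\<And>k. Ck_on k UNIV \<eta>"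
    and "continuous_on UNIV \<eta>'" and "\<And>x. \<eta>' x \<ge> 0"
    and "\<And>x. x \<le> 0 \<Longrightarrow> \<eta> x = 0" and "\<And>x. x \<ge> 1 \<Longrightarrow> \<eta> x = 1"
    and "\<And>x. x \<le> 0 \<or> x \<ge> 1 \<Longrightarrow> \<eta>' x = 0"
proof -
  have "isCont bump x" for x
    using continuous_bump[of UNIV] by (simp add: continuous_on_eq_continuous_at)
  then have "\<exists>F. \<forall>x. - \<infinity> < ereal x \<longrightarrow> ereal x < \<infinity> \<longrightarrow> (F has_vector_derivative bump x) (at x)"
    by (intro einterval_antiderivative) auto
  then obtain F where F: "(F has_real_derivative bump x) (at x)" for x
    by (auto simp: has_real_derivative_iff_has_vector_derivative)
  have less: "F 0 < F 1"
    by (rule DERIV_pos_imp_increasing_open)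
      (use F bump_pos in \<open>auto intro!: continuous_at_imp_continuous_on DERIV_isCont\<close>)
  define c where "c = 1 / (F 1 - F 0)"
  have const: "F x = F y" if "x \<le> y" and zero: "\<And>z. x \<le> z \<Longrightarrow> z \<le> y \<Longrightarrow> bump z = 0" for x y
  proof -
    have "\<exists>C. \<forall>z\<in>{x..y}. F z = C"
    proof (rule has_field_derivative_zero_constant)
      show "(F has_real_derivative 0) (at z within {x..y})" if "z \<in> {x..y}" for z
        using F[of z] zero[of z] that by (auto intro: has_field_derivative_at_within)
    qed simp
    then show ?thesis
      using \<open>x \<le> y\<close> by (metis atLeastAtMost_iff order_refl)
  qed
  have left: "F x = F 0" if "x \<le> 0" for x
    using that by (intro const bump_outside) auto
  have right: "F x = F 1" if "x \<ge> 1" for x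
    using that by (intro const[symmetric] bump_outside) auto
  have c: "c > 0" "c * (F 1 - F 0) = 1"
    using less by (auto simp: c_def)
  have d: "((\<lambda>x. c * (F x - F 0)) has_real_derivative c * bump x) (at x)" for x
    using F by (auto intro!: derivative_eq_intros)
  show thesis
  proof (rule that[of "\<lambda>x. c * (F x - F 0)" "\<lambda>x. c * bump x"])
    show "((\<lambda>x. c * (F x - F 0)) has_real_derivative c * bump x) (at x)" for x
      by (rule d)
    show "Ck_on k UNIV (\<lambda>x. c * (F x - F 0))" for k
      \<comment> \<open>Order k + 1 is proved and then weakened to k, which avoids treating k = 0
        separately.\<close>
      by (rule Ck_on_SucD, rule Ck_on_SucI[OF d Ck_on_cmult[OF Ck_on_bump]])
    show "continuous_on UNIV (\<lambda>x. c * bump x)"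
      by (rule continuous_on_mult_left[OF continuous_bump])
    show "c * bump x \<ge> 0" for x
      using c bump_nonneg by simp
    show "c * (F x - F 0) = 0" if "x \<le> 0" for x
      using left[OF that] by simp
    show "c * (F x - F 0) = 1" if "x \<ge> 1" for x
      using right[OF that] c by simp
    show "c * bump x = 0" if "x \<le> 0 \<or> x \<ge> 1" for x
      using bump_outside[OF that] by simp
  qed
qed

subsection \<open>Transport and the leading amplitude\<close>

text \<open>The ray has velocity (1, -\<omega>), the direction of differentiation in the transport
  equation. Along the ray the equation is therefore a scalar linear ODE with coefficient
  \<kappa>.\<close>

lemma transport_along_ray:
  fixes a :: "'n::finite spacetime \<Rightarrow> complex" and \<omega> y :: "real ^ 'n"
  assumes diff: "a differentiable_on slab T0 T"
    and transport: "\<And>x. x \<in> slab T0 T \<Longrightarrow>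
      dt (slab T0 T) a x - (\<Sum>j\<in>UNIV. (\<omega> $ j) *\<^sub>R dx (slab T0 T) j a x) = of_real (\<kappa> x) * a x"
    and cont: "continuous_on {T0..T} (\<lambda>s. \<kappa> (s, y - s *\<^sub>R \<omega>))"
    and t: "t \<in> {T0..T}"
  shows "a (t, y - t *\<^sub>R \<omega>) =
    of_real (exp (integral {T0..t} (\<lambda>s. \<kappa> (s, y - s *\<^sub>R \<omega>)))) * a (T0, y - T0 *\<^sub>R \<omega>)"
proof -
  define r where "r s = (s, y - s *\<^sub>R \<omega>)" for s
  define K where "K s = integral {T0..s} (\<lambda>s. \<kappa> (r s))" for s
  let ?S = "slab T0 T :: 'n spacetime set"
  have r_in: "r s \<in> ?S" if "s \<in> {T0..T}" for s
    using that by (auto simp: r_def slab_def)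
  have a': "((\<lambda>s. a (r s)) has_vector_derivative of_real (\<kappa> (r s)) * a (r s)) (at s within {T0..T})"
    if s: "s \<in> {T0..T}" for s
  proof -
    define D where "D = frechet_derivative a (at (r s) within ?S)"
    have D: "(a has_derivative D) (at (r s) within ?S)"
      using diff r_in[OF s] unfolding D_def differentiable_on_def
      by (simp add: frechet_derivative_works[symmetric])
    then have lin: "linear D"
      by (rule has_derivative_linear)
    have "(r has_vector_derivative (1, - \<omega>)) (at s within {T0..T})"
      unfolding r_def has_vector_derivative_def
      by (auto intro!: derivative_eq_intros)
    \<comment> \<open>Restricting from the slab to the ray keeps the one-sided derivatives at the
      end times within the scope of the chain rule.\<close>
    moreover have "(a has_derivative D) (at (r s) within r ` {T0..T})"
      using D by (rule has_derivative_subset) (auto simp: r_in simp del: atLeastAtMost_iff)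
    ultimately have "((a \<circ> r) has_vector_derivative D (1, - \<omega>)) (at s within {T0..T})"
      by (rule vector_derivative_diff_chain_within)
    moreover have "D (1, - \<omega>) = of_real (\<kappa> (r s)) * a (r s)"
    proof -
      \<comment> \<open>Decomposing the velocity into coordinate vectors lets linearity of D produce
        exactly the left side of the transport equation.\<close>
      have "(1, - \<omega>) = (1, 0) - (\<Sum>j\<in>UNIV. (\<omega> $ j) *\<^sub>R (0 :: real, axis j 1 :: real ^ 'n))"
        by (simp add: prod_eq_iff fst_sum snd_sum vec_eq_iff axis_def if_distrib sum.delta cong: if_cong)
      then have "D (1, - \<omega>) = D (1, 0) - (\<Sum>j\<in>UNIV. (\<omega> $ j) *\<^sub>R D (0, axis j 1))"
        by (simp only: linear_diff[OF lin] linear_sum[OF lin] linear_cmul[OF lin])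
      also have "\<dots> = of_real (\<kappa> (r s)) * a (r s)"
        using transport[OF r_in[OF s]] by (simp add: D_def dt_def dx_def pderiv_within_def)
      finally show ?thesis .
    qed
    ultimately show ?thesis
      by (simp add: o_def)
  qed
  have K': "(K has_real_derivative \<kappa> (r s)) (at s within {T0..T})" if "s \<in> {T0..T}" for s
    unfolding K_def
    using integral_has_real_derivative[OF _ that, of "\<lambda>s. \<kappa> (r s)"] cont by (simp add: r_def)
  \<comment> \<open>\<open>exp (- K s)\<close> is the integrating factor: its product with the
    amplitude along the ray is constant.\<close>
  obtain c where "exp (- K s) *\<^sub>R a (r s) = c" if "s \<in> {T0..T}" for s
  proof (rule has_vector_derivative_zero_constant[of "{T0..T}" "\<lambda>s. exp (- K s) *\<^sub>R a (r s)"])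
    fix s assume s: "s \<in> {T0..T}"
    have "((\<lambda>s. exp (- K s)) has_real_derivative - \<kappa> (r s) * exp (- K s)) (at s within {T0..T})"
      by (rule derivative_eq_intros K'[OF s] refl)+ simp
    from has_vector_derivative_scaleR[OF this a'[OF s]]
    show "((\<lambda>s. exp (- K s) *\<^sub>R a (r s)) has_vector_derivative 0) (at s within {T0..T})"
      by (rule has_vector_derivative_eq_rhs) (simp add: scaleR_conv_of_real algebra_simps)
  qed auto
  then have "exp (- K t) *\<^sub>R a (r t) = exp (- K T0) *\<^sub>R a (r T0)"
    using t by (metis atLeastAtMost_iff order_refl order_trans)
  then have "exp (K t) *\<^sub>R exp (- K t) *\<^sub>R a (r t) = exp (K t) *\<^sub>R a (r T0)"
    by (simp add: K_def)
  then have "a (r t) = exp (K t) *\<^sub>R a (r T0)"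
    unfolding scaleR_scaleR exp_add[symmetric] by simp
  then show ?thesis
    by (simp add: K_def r_def scaleR_conv_of_real[where 'a = complex])
qed

section \<open>Separating the harmonics as h tends to 0\<close>

text \<open>Every phase \<theta> is attained modulo 2 pi by \<xi>/h for arbitrarily small h, while
  the bound tends to 0. So the trigonometric polynomial in \<theta> vanishes identically, and so do
  its coefficients.\<close>

lemma oscillating_sum_small_pos:
  fixes a b c :: complex and \<xi> K :: real
  assumes "\<xi> > 0"
    and small: "\<forall>\<^sub>F h in at_right 0. norm (a + cis (\<xi> / h) * b + cis (- (\<xi> / h)) * c) \<le> h * K"
  shows "b = 0 \<and> c = 0"
proof -
  have zero: "a + cis \<theta> * b + cis (- \<theta>) * c = 0" for \<theta>
  proof -
    \<comment> \<open>Along this sequence the phase \<open>\<xi> / h\<close> equals \<open>\<theta>\<close> modulo \<open>2 * pi\<close>.\<close>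
    define H where "H k = \<xi> / (\<theta> + 2 * pi * real k)" for k :: nat
    have at_top: "filterlim (\<lambda>k. \<theta> + 2 * pi * real k) at_top sequentially"
      by (intro filterlim_tendsto_add_at_top[OF tendsto_const]
          filterlim_tendsto_pos_mult_at_top[OF tendsto_const] filterlim_real_sequentially) simp
    then have "H \<longlonglongrightarrow> 0"
      unfolding H_def by (intro tendsto_divide_0[OF tendsto_const] filterlim_at_top_imp_at_infinity)
    \<comment> \<open>Since \<theta> may be negative, \<open>H k\<close> is known to be positive
      only for large k.\<close>
    moreover have pos: "\<forall>\<^sub>F k in sequentially. \<theta> + 2 * pi * real k > 0"
      using at_top by (simp add: filterlim_at_top_dense)
    then have "\<forall>\<^sub>F k in sequentially. H k \<in> {0<..} \<and> H k \<noteq> 0"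
      by eventually_elim (use assms(1) in \<open>auto simp: H_def\<close>)
    ultimately have H: "filterlim H (at_right 0) sequentially"
      unfolding filterlim_at by blast
    have "\<forall>\<^sub>F k in sequentially. norm (a + cis (\<xi> / H k) * b + cis (- (\<xi> / H k)) * c) \<le> H k * K"
      using eventually_compose_filterlim[OF small H] .
    then have "\<forall>\<^sub>F k in sequentially. norm (a + cis \<theta> * b + cis (- \<theta>) * c) \<le> H k * K"
      using pos
    proof eventually_elim
      case (elim k)
      have "\<xi> / H k = \<theta> + 2 * pi * real k"
        using elim assms(1) by (simp add: H_def)
      moreover have "cis (\<theta> + 2 * pi * real k) = cis \<theta>"
        by (simp add: cis_mult[symmetric] cis_multiple_2pi)
      moreover have "cis (- (\<theta> + 2 * pi * real k)) = cis (- \<theta>)"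
        using calculation(2) by (metis cis_cnj)
      ultimately show ?case
        using elim(1) by simp
    qed
    moreover have "(\<lambda>k. H k * K) \<longlonglongrightarrow> 0"
      using tendsto_mult_left_zero[OF \<open>H \<longlonglongrightarrow> 0\<close>] .
    ultimately have "norm (a + cis \<theta> * b + cis (- \<theta>) * c) \<le> 0"
      by (intro tendsto_lowerbound[where F = sequentially]) auto
    then show ?thesis by simp
  qed
  \<comment> \<open>Three phases suffice: 0 and pi separate a from b + c, and pi/2 then separates b
    from c.\<close>
  have "a + b + c = 0" "a - b - c = 0"
    using zero[of 0] zero[of pi] by (simp_all add: cis.ctr complex_eq_iff)
  then have "2 * a = 0" "b + c = - a"
    by (auto simp: algebra_simps)
  then have "a = 0" "b + c = 0"
    by auto
  moreover have "\<i> * (b - c) = 0"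
    using zero[of "pi / 2"] \<open>a = 0\<close> by (simp add: algebra_simps)
  ultimately show ?thesis
    by (simp add: add_eq_0_iff2)
qed

text \<open>Changing the sign of \<xi> exchanges b and c, which is why the positive case concludes
  for both.\<close>

lemma oscillating_sum_small:
  fixes a b c :: complex and \<xi> K :: real
  assumes "\<xi> \<noteq> 0"
    and "\<forall>\<^sub>F h in at_right 0. norm (a + cis (\<xi> / h) * b + cis (- (\<xi> / h)) * c) \<le> h * K"
  shows "b = 0"
proof (cases "\<xi> > 0")
  case True
  then show ?thesis using oscillating_sum_small_pos assms(2) by blast
next
  case False
  then have "- \<xi> > 0" using assms(1) by simp
  moreover have "\<forall>\<^sub>F h in at_right 0.
      norm (a + cis (- \<xi> / h) * c + cis (- (- \<xi> / h)) * b) \<le> h * K"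
    using assms(2) by (simp add: add.commute add.left_commute)
  ultimately show ?thesis using oscillating_sum_small_pos by blast
qed

text \<open>Subtracting the two expansions and dividing by h leaves the difference of the order-zero
  harmonics, up to a term of size O(h). The phase must be nonzero: where it vanishes the
  exponentials are 1 for every h and the harmonics cannot be told apart.\<close>

lemma leading_amplitude_determined:
  fixes a1 a2 :: "int \<Rightarrow> nat \<Rightarrow> 'n::finite spacetime \<Rightarrow> complex"
  assumes cont1: "\<And>m p. continuous_on UNIV (\<lambda>y. a1 m p (t, y))"
    and cont2: "\<And>m p. continuous_on UNIV (\<lambda>y. a2 m p (t, y))"
    and eq: "\<forall>\<^sub>F h in at_right 0. \<forall>y.
      expansion 1 \<phi> V W a1 E1 h (t, y) = expansion 1 \<phi> V W a2 E2 h (t, y)"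
    and bound1: "\<forall>\<^sub>F h in at_right 0. L2_Linf_bound C1 (\<lambda>y. E1 h (t, y))"
    and bound2: "\<forall>\<^sub>F h in at_right 0. L2_Linf_bound C2 (\<lambda>y. E2 h (t, y))"
    and phase: "mink (t, y) W \<noteq> 0"
  shows "a1 1 0 (t, y) = a2 1 0 (t, y)"
proof -
  define d where "d m p y = a1 m p (t, y) - a2 m p (t, y)" for m p y
  \<comment> \<open>The difference of the two sums over m at order p; for N = 1 the harmonics are
    -1, 0 and 1.\<close>
  define S where "S p h y = d 0 p y + cis (mink (t, y) W / h) * d 1 p y
      + cis (- (mink (t, y) W / h)) * d (-1) p y" for p and h :: real and y
  have cont_mink: "continuous_on UNIV (\<lambda>y. mink (t, y) W)"
    unfolding mink_def by (auto intro!: continuous_intros)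
  have cont_S: "continuous_on UNIV (S p h)" for p h
  proof -
    have "continuous_on UNIV (d m p)" for m
      unfolding d_def by (intro continuous_intros cont1 cont2)
    moreover have "continuous_on UNIV (\<lambda>y. cis (mink (t, y) W / h))"
        "continuous_on UNIV (\<lambda>y. cis (- (mink (t, y) W / h)))"
      unfolding divide_inverse by (intro continuous_intros cont_mink)+
    ultimately show ?thesis
      unfolding S_def by (intro continuous_on_add continuous_on_mult)
  qed
  have ints: "{-1..1::int} = {-1, 0, 1}" "{0..1::nat} = {0, 1}"
    by auto
  \<comment> \<open>The remainders are bounded only almost everywhere, but all other terms are continuous in \<open>y\<close>.\<close>
  have "\<forall>\<^sub>F h in at_right 0.
      norm (S 0 h y) \<le> h * (C1 + C2 + norm (d 0 1 y) + norm (d 1 1 y) + norm (d (-1) 1 y))"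
    using eq bound1 bound2 eventually_at_right_less[of 0]
  proof eventually_elim
    case (elim h)
    have D: "of_real h * (S 0 h z + of_real h * S 1 h z + of_real h * (E1 h (t, z) - E2 h (t, z))) = 0" for z
      using elim(1)[rule_format, of z]
      by (simp add: expansion_def ints S_def d_def power2_eq_square algebra_simps)
    have "AE z in lborel. z \<in> {z. norm (S 0 h z + of_real h * S 1 h z) \<le> h * (C1 + C2)}"
    proof -
      have "AE z in lborel. norm (E1 h (t, z)) \<le> C1" "AE z in lborel. norm (E2 h (t, z)) \<le> C2"
        using elim(2,3) by (auto simp: L2_Linf_bound_def)
      then show ?thesis
      proof eventually_elim
        case (elim z)
        have "S 0 h z + of_real h * S 1 h z = - (of_real h * (E1 h (t, z) - E2 h (t, z)))"
          using D[of z] \<open>h > 0\<close> by (simp add: add_eq_0_iff2)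
        then have "norm (S 0 h z + of_real h * S 1 h z) = h * norm (E1 h (t, z) - E2 h (t, z))"
          using \<open>h > 0\<close> by (simp add: norm_mult)
        also have "\<dots> \<le> h * (C1 + C2)"
          using elim \<open>h > 0\<close> norm_triangle_ineq4[of "E1 h (t, z)" "E2 h (t, z)"]
          by (intro mult_left_mono) auto
        finally show ?case by simp
      qed
    qed
    \<comment> \<open>A closed set of full measure is the whole space, so the estimate holds at the
      given y.\<close>
    then have "AE z in lebesgue. z \<in> {z. norm (S 0 h z + of_real h * S 1 h z) \<le> h * (C1 + C2)}"
      by (rule AE_completion)
    moreover have "closed {z. norm (S 0 h z + of_real h * S 1 h z) \<le> h * (C1 + C2)}"
      by (intro closed_Collect_le continuous_intros cont_S)
    ultimately have "norm (S 0 h y + of_real h * S 1 h y) \<le> h * (C1 + C2)"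
      using mem_closed_if_AE_lebesgue by blast
    moreover have "norm (S 1 h y) \<le> norm (d 0 1 y) + norm (d 1 1 y) + norm (d (-1) 1 y)"
      unfolding S_def by (intro order.trans[OF norm_triangle_ineq] add_mono) (auto simp: norm_mult)
    then have "norm (of_real h * S 1 h y) \<le> h * (norm (d 0 1 y) + norm (d 1 1 y) + norm (d (-1) 1 y))"
      using \<open>h > 0\<close> by (simp add: norm_mult)
    moreover have "norm (S 0 h y) \<le> norm (S 0 h y + of_real h * S 1 h y) + norm (of_real h * S 1 h y)"
      using norm_triangle_ineq4[of "S 0 h y + of_real h * S 1 h y" "of_real h * S 1 h y"] by simp
    ultimately show ?case
      by (simp add: algebra_simps)
  qed
  then have "d 1 0 y = 0"
    unfolding S_def by (rule oscillating_sum_small[OF phase])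
  then show ?thesis
    by (simp add: d_def)
qed

subsection \<open>Steps along a ray\<close>

lemma continuous_on_compose_curried:
  assumes "continuous_on UNIV (\<lambda>(x, y). q x y)" "continuous_on S f" "continuous_on S g"
  shows "continuous_on S (\<lambda>s. q (f s) (g s))"
  using continuous_on_compose2[OF assms(1) continuous_on_Pair[OF assms(2,3)]] by simp

text \<open>The weight lives on b - \<epsilon> < s < b, inside the interval even when b = T', while
  the second argument of G sweeps from u to 0. In the limit only the integral of \<open>G b\<close>
  from 0 to u remains. It vanishes for every u, so differentiating in u gives the claim.\<close>

lemma step_concentrates:
  fixes G :: "real \<Rightarrow> real \<Rightarrow> real"
  assumes \<eta>: "\<And>x. (\<eta> has_real_derivative \<eta>' x) (at x)" "continuous_on UNIV \<eta>'" "\<And>x. \<eta>' x \<ge> 0"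
      "\<And>x. x \<le> 0 \<Longrightarrow> \<eta> x = 0" "\<And>x. x \<ge> 1 \<Longrightarrow> \<eta> x = 1"
      "\<And>x. x \<le> 0 \<or> x \<ge> 1 \<Longrightarrow> \<eta>' x = 0"
    and cont: "continuous_on UNIV (\<lambda>(s, v). G s v)"
    and b: "T0 < b" "b \<le> T'"
    and zero: "\<And>\<epsilon> u. 0 < \<epsilon> \<Longrightarrow> \<epsilon> < b - T0 \<Longrightarrow>
      integral {T0..T'} (\<lambda>s. G s (u * \<eta> ((b - s) / \<epsilon>)) * (u * \<eta>' ((b - s) / \<epsilon>) / \<epsilon>)) = 0"
  shows "G b v = 0"
proof -
  note contG = continuous_on_compose_curried[OF cont]
  have "isCont (G b) x" for x
    using contG[of UNIV "\<lambda>_. b" "\<lambda>v. v"] by (simp add: continuous_on_eq_continuous_at)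
  then have "\<exists>F. \<forall>x. - \<infinity> < ereal x \<longrightarrow> ereal x < \<infinity> \<longrightarrow> (F has_vector_derivative G b x) (at x)"
    by (intro einterval_antiderivative) auto
  then obtain F where F: "(F has_real_derivative G b x) (at x)" for x
    by (auto simp: has_real_derivative_iff_has_vector_derivative)
  have cont\<eta>: "continuous_on S (\<lambda>s. \<eta> (f s))" "continuous_on S (\<lambda>s. \<eta>' (f s))"
    if "continuous_on S f" for S :: "real set" and f
    using that \<eta>(1,2)
    by (auto intro: continuous_on_compose2[of UNIV] continuous_at_imp_continuous_on DERIV_isCont)
  have range: "0 \<le> \<eta> x" "\<eta> x \<le> 1" for x
  proof -
    have mono: "\<eta> x \<le> \<eta> y" if "x \<le> y" for x y
      by (rule DERIV_nonneg_imp_nondecreasing[OF that]) (use \<eta>(1,3) in blast)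
    show "0 \<le> \<eta> x" "\<eta> x \<le> 1"
      using mono[of 0 x] mono[of x 1] \<eta>(4)[of x] \<eta>(4)[of 0] \<eta>(5)[of x] \<eta>(5)[of 1] by linarith+
  qed
  have F_le: "\<bar>F u - F 0\<bar> \<le> \<delta> * \<bar>u\<bar>" if "\<delta> > 0" for u \<delta>
  proof -
    \<comment> \<open>This compact set contains the pairs (s, \<open>\<sigma> s\<close>) and (b,
      \<open>\<sigma> s\<close>), because \<eta> takes values in [0, 1].\<close>
    let ?K = "{T0..T'} \<times> {- \<bar>u\<bar>..\<bar>u\<bar>}"
    have "uniformly_continuous_on ?K (\<lambda>(s, v). G s v)"
      by (intro compact_uniformly_continuous continuous_on_subset[OF cont] compact_Times) auto
    then obtain e where e: "e > 0" and
      e': "\<And>p p'. p \<in> ?K \<Longrightarrow> p' \<in> ?K \<Longrightarrow> dist p' p < e \<Longrightarrow>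
        dist (case p' of (s, v) \<Rightarrow> G s v) (case p of (s, v) \<Rightarrow> G s v) < \<delta>"
      using \<open>\<delta> > 0\<close> unfolding uniformly_continuous_on_def by meson
    \<comment> \<open>Below e, so that uniform continuity applies throughout the transition; below b
      - T0, so that the step has reached height 1 at time T0.\<close>
    define \<epsilon> where "\<epsilon> = min (e / 2) ((b - T0) / 2)"
    have \<epsilon>: "\<epsilon> > 0" "\<epsilon> < e" "\<epsilon> < b - T0"
      using e b by (auto simp: \<epsilon>_def min_less_iff_disj)
    define \<sigma> where "\<sigma> s = u * \<eta> ((b - s) / \<epsilon>)" for s
    define \<rho> where "\<rho> s = \<eta>' ((b - s) / \<epsilon>) / \<epsilon>" for s
    have \<sigma>': "(\<sigma> has_real_derivative - (u * \<rho> s)) (at s)" for s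
      unfolding \<sigma>_def \<rho>_def
      by (rule derivative_eq_intros DERIV_chain2[OF \<eta>(1)] refl)+ (use \<epsilon> in auto)
    have ends: "\<eta> ((b - T0) / \<epsilon>) = 1" "\<eta> ((b - T') / \<epsilon>) = 0"
      using \<epsilon> b by (auto intro!: \<eta>(4,5) simp: divide_nonpos_pos)
    have cont_\<sigma>: "continuous_on S \<sigma>" "continuous_on S \<rho>" for S
      unfolding \<sigma>_def \<rho>_def by (intro continuous_intros cont\<eta>; use \<epsilon> in simp)+
    \<comment> \<open>With the first argument frozen at b, the substitution v =
      \<open>\<sigma> s\<close> evaluates the integral exactly.\<close>
    have "((\<lambda>s. G b (\<sigma> s) * (u * \<rho> s)) has_integral (- F (\<sigma> T') - - F (\<sigma> T0))) {T0..T'}"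
    proof (rule fundamental_theorem_of_calculus)
      show "((\<lambda>s. - F (\<sigma> s)) has_vector_derivative G b (\<sigma> s) * (u * \<rho> s)) (at s within {T0..T'})" for s
        using DERIV_minus[OF DERIV_chain2[OF F \<sigma>'[of s]]]
        by (auto simp: has_real_derivative_iff_has_vector_derivative intro: has_vector_derivative_at_within)
    qed (use b in simp)
    then have I1: "((\<lambda>s. G b (\<sigma> s) * (u * \<rho> s)) has_integral (F u - F 0)) {T0..T'}"
      by (simp add: \<sigma>_def ends)
    \<comment> \<open>The weight \<rho> has mass 1 for every \<epsilon>, so freezing the first
      argument costs at most \<delta> times |u|.\<close>
    have "(\<rho> has_integral (- \<eta> ((b - T') / \<epsilon>) - - \<eta> ((b - T0) / \<epsilon>))) {T0..T'}"
    proof (rule fundamental_theorem_of_calculus)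
      have "((\<lambda>s. - \<eta> ((b - s) / \<epsilon>)) has_real_derivative \<rho> s) (at s)" for s
        unfolding \<rho>_def by (rule derivative_eq_intros DERIV_chain2[OF \<eta>(1)] refl)+ (use \<epsilon> in auto)
      then show "((\<lambda>s. - \<eta> ((b - s) / \<epsilon>)) has_vector_derivative \<rho> s) (at s within {T0..T'})" for s
        by (auto simp: has_real_derivative_iff_has_vector_derivative intro: has_vector_derivative_at_within)
    qed (use b in simp)
    then have "(\<rho> has_integral 1) {T0..T'}"
      by (simp add: ends)
    then have I2: "((\<lambda>s. \<delta> * \<bar>u\<bar> * \<rho> s) has_integral \<delta> * \<bar>u\<bar>) {T0..T'}"
      using has_integral_mult_right[of \<rho> 1 "{T0..T'}" "\<delta> * \<bar>u\<bar>"] by simp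
    have "(\<lambda>s. G s (\<sigma> s) * (u * \<rho> s)) integrable_on {T0..T'}"
      by (intro integrable_continuous_real continuous_intros contG cont_\<sigma>)
    moreover have "integral {T0..T'} (\<lambda>s. G s (\<sigma> s) * (u * \<rho> s)) = 0"
      using zero[OF \<epsilon>(1,3), of u] by (simp add: \<sigma>_def \<rho>_def)
    ultimately have "((\<lambda>s. G s (\<sigma> s) * (u * \<rho> s)) has_integral 0) {T0..T'}"
      by (simp add: has_integral_iff)
    then have I3: "((\<lambda>s. G b (\<sigma> s) * (u * \<rho> s) - G s (\<sigma> s) * (u * \<rho> s)) has_integral F u - F 0) {T0..T'}"
      using has_integral_diff[OF I1] by fastforce
    have "norm (G b (\<sigma> s) * (u * \<rho> s) - G s (\<sigma> s) * (u * \<rho> s)) \<le> \<delta> * \<bar>u\<bar> * \<rho> s"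
      if s: "s \<in> {T0..T'}" for s
    proof (cases "0 < (b - s) / \<epsilon> \<and> (b - s) / \<epsilon> < 1")
      case True
      then have "\<bar>b - s\<bar> < e"
        using \<epsilon> by (auto simp: field_simps)
      moreover have "\<bar>\<sigma> s\<bar> \<le> \<bar>u\<bar>"
        using range by (auto simp: \<sigma>_def abs_mult mult_left_le)
      ultimately have "\<bar>G b (\<sigma> s) - G s (\<sigma> s)\<bar> \<le> \<delta>"
        using e'[of "(s, \<sigma> s)" "(b, \<sigma> s)"] s b
        by (force simp: dist_Pair_Pair dist_real_def)
      moreover have "\<rho> s \<ge> 0"
        using \<eta>(3) \<epsilon> by (simp add: \<rho>_def)
      ultimately have "\<bar>G b (\<sigma> s) - G s (\<sigma> s)\<bar> * (\<bar>u\<bar> * \<rho> s) \<le> \<delta> * (\<bar>u\<bar> * \<rho> s)"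
        by (intro mult_right_mono) auto
      then show ?thesis
        using \<open>\<rho> s \<ge> 0\<close> by (simp add: left_diff_distrib[symmetric] abs_mult mult.assoc)
    next
      case False
      then have "\<rho> s = 0"
        unfolding \<rho>_def by (subst \<eta>(6)) auto
      then show ?thesis by simp
    qed
    then have "norm (integral {T0..T'} (\<lambda>s. G b (\<sigma> s) * (u * \<rho> s) - G s (\<sigma> s) * (u * \<rho> s)))
        \<le> integral {T0..T'} (\<lambda>s. \<delta> * \<bar>u\<bar> * \<rho> s)"
      using I2 I3 by (intro integral_norm_bound_integral) blast+
    then show ?thesis
      unfolding integral_unique[OF I2] integral_unique[OF I3] by simp
  qed
  have "F u = F 0" for u
  proof (cases "u = 0")
    case False
    have "\<bar>F u - F 0\<bar> \<le> 0"
    proof (rule field_le_epsilon)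
      fix e :: real assume "e > 0"
      then show "\<bar>F u - F 0\<bar> \<le> 0 + e"
        using F_le[of "e / \<bar>u\<bar>" u] False by simp
    qed
    then show ?thesis by simp
  qed simp
  then have "F = (\<lambda>_. F 0)" by blast
  then have "(F has_real_derivative 0) (at v)"
    by (metis DERIV_const)
  then show ?thesis
    using F DERIV_unique by blast
qed

section \<open>From the data to integrals of q along rays\<close>

text \<open>The phase \<langle>x, W\<rangle> keeps the value \<omega> \<bullet> y along the ray,
  which gives the initial amplitude at T0; A = 1 and B = 0 make it real.\<close>

lemma leading_amplitude_on_ray:
  fixes \<omega> y :: "real ^ 'n::finite"
  assumes ampl: "amplitudes q T0 t1 T \<phi> \<psi> (1, \<omega>) (-1, \<omega>) 1 0 a"
    and q: "continuous_on UNIV (\<lambda>(x, s). q x s)"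
    and \<phi>: "continuous_on UNIV \<phi>" "continuous_on UNIV (deriv \<phi>)"
    and \<omega>: "\<omega> \<bullet> \<omega> = 1" and t: "T0 < t1" "T0 \<le> t" "t \<le> T"
  shows "a 1 0 (t, y - t *\<^sub>R \<omega>) = of_real (exp (integral {T0..t}
      (\<lambda>s. 2 * (q (s, y - s *\<^sub>R \<omega>) (\<phi> (\<omega> \<bullet> y - 2 * s)) * deriv \<phi> (\<omega> \<bullet> y - 2 * s))))) *
      (of_real (\<psi> (\<omega> \<bullet> y)) / 2)"
proof -
  have mink_V: "mink (s, z) (1, \<omega>) = \<omega> \<bullet> z - s" and mink_W: "mink (s, z) (-1, \<omega>) = \<omega> \<bullet> z + s" for s z
    by (auto simp: mink_def inner_vec_def mult.commute)
  have ray: "\<omega> \<bullet> (y - s *\<^sub>R \<omega>) = \<omega> \<bullet> y - s" for s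
    using \<omega> by (simp add: inner_diff_right)
  \<comment> \<open>Here the sign in V matters: time component 1 gives the factor 2, whereas -1 with
    the same \<omega> would give 0 and hide q from the amplitude.\<close>
  have "mink (c *\<^sub>R time_flip (1, \<omega>)) (time_flip (-1, \<omega>)) = 2 * c" for c
    using \<omega> by (simp add: mink_def time_flip_def inner_vec_def mult.assoc sum_distrib_left[symmetric])
  then have transport: "dt (slab T0 T) (a 1 0) x - (\<Sum>j\<in>UNIV. (\<omega> $ j) *\<^sub>R dx (slab T0 T) j (a 1 0) x)
      = of_real (2 * (q x (\<phi> (mink x (1, \<omega>))) * deriv \<phi> (mink x (1, \<omega>)))) * a 1 0 x"
    if "x \<in> slab T0 T" for x
    using ampl that by (simp add: amplitudes_def)
  have "Ck_on (Suc 0) (slab T0 T) (a 1 0)"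
    using ampl by (auto simp: amplitudes_def smooth_on_def simp del: Ck_on.simps)
  then have diff: "a 1 0 differentiable_on slab T0 T"
    by simp
  have "continuous_on {T0..T} (\<lambda>s. 2 * (q (s, y - s *\<^sub>R \<omega>) (\<phi> (mink (s, y - s *\<^sub>R \<omega>) (1, \<omega>))) *
      deriv \<phi> (mink (s, y - s *\<^sub>R \<omega>) (1, \<omega>))))"
    unfolding mink_V ray
    by (intro continuous_intros continuous_on_compose_curried[OF q]
        continuous_on_compose2[OF \<phi>(1)] continuous_on_compose2[OF \<phi>(2)]) auto
  from transport_along_ray[OF diff transport this, of t]
  have "a 1 0 (t, y - t *\<^sub>R \<omega>) = of_real (exp (integral {T0..t}
      (\<lambda>s. 2 * (q (s, y - s *\<^sub>R \<omega>) (\<phi> (\<omega> \<bullet> y - 2 * s)) * deriv \<phi> (\<omega> \<bullet> y - 2 * s))))) *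
      a 1 0 (T0, y - T0 *\<^sub>R \<omega>)"
    using t by (simp add: mink_V ray)
  moreover have "a 1 0 (T0, y - T0 *\<^sub>R \<omega>) = of_real (\<psi> (\<omega> \<bullet> y)) / 2"
    using ampl t by (simp add: amplitudes_def slab_def mink_W ray)
  ultimately show ?thesis
    by simp
qed

text \<open>At time T' both leading amplitudes are a real exponential times the same nonzero initial
  value. Cancelling that value and using injectivity of exp leaves the integrals.\<close>

lemma ray_integrals_eq:
  fixes q1 q2 :: "'n::finite spacetime \<Rightarrow> real \<Rightarrow> real" and u1 u2 :: "'n solution_family"
    and \<omega> y :: "real ^ 'n"
  assumes fam1: "oscillatory_family q1 T0 T u1" and fam2: "oscillatory_family q2 T0 T u2"
    and data: "same_data_at T' u1 u2"
    and q1: "continuous_on UNIV (\<lambda>(x, s). q1 x s)" and q2: "continuous_on UNIV (\<lambda>(x, s). q2 x s)"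
    and \<phi>: "test_function \<phi>" "continuous_on UNIV \<phi>" "continuous_on UNIV (deriv \<phi>)"
    and \<omega>: "norm \<omega> = 1" and t: "T0 < T'" "T' < T" and phase: "\<omega> \<bullet> y \<noteq> 0"
  shows "integral {T0..T'} (\<lambda>s. q1 (s, y - s *\<^sub>R \<omega>) (\<phi> (\<omega> \<bullet> y - 2 * s)) * deriv \<phi> (\<omega> \<bullet> y - 2 * s)) =
    integral {T0..T'} (\<lambda>s. q2 (s, y - s *\<^sub>R \<omega>) (\<phi> (\<omega> \<bullet> y - 2 * s)) * deriv \<phi> (\<omega> \<bullet> y - 2 * s))"
proof -
  \<comment> \<open>The bump is shifted so that \<omega> \<bullet> y falls on its midpoint, where it
    is positive.\<close>
  define \<psi> where "\<psi> = (\<lambda>t. bump (t - (\<omega> \<bullet> y - 1 / 2)))"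
  define V W where "V = (1 :: real, \<omega>)" and "W = (-1 :: real, \<omega>)"
  have dirs: "V \<in> V_directions" "W \<in> W_directions"
    using \<omega> by (auto simp: V_def W_def V_directions_def W_directions_def)
  have \<psi>: "test_function \<psi>" "\<psi> (\<omega> \<bullet> y) \<noteq> 0"
    using test_function_bump bump_pos[of "1 / 2"] by (simp_all add: \<psi>_def)
  have \<omega>': "\<omega> \<bullet> \<omega> = 1"
    using \<omega> by (simp add: power2_norm_eq_inner[symmetric])
  have expand: "\<exists>t1>T0. \<exists>a E C. amplitudes q T0 t1 T \<phi> \<psi> V W 1 0 a \<and>
      (\<forall>\<^sub>F h in at_right 0. \<forall>x\<in>slab T0 T. of_real (u \<phi> \<psi> V W 1 0 h x) = expansion 1 \<phi> V W a E h x) \<and>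
      (\<forall>\<^sub>F h in at_right 0. L2_Linf_bound C (\<lambda>y. E h (T', y)))"
    if fam: "oscillatory_family q T0 T u" for q and u :: "'n solution_family"
  proof -
    have "oscillatory_solution q T0 T \<phi> \<psi> V W 1 0 (u \<phi> \<psi> V W 1 0)"
      using fam dirs \<phi>(1) \<psi>(1) by (simp add: oscillatory_family_def)
    then obtain t1 a E where "t1 > T0" and a: "amplitudes q T0 t1 T \<phi> \<psi> V W 1 0 a"
      "\<forall>\<^sub>F h in at_right 0. \<forall>x\<in>slab T0 T. of_real (u \<phi> \<psi> V W 1 0 h x) = expansion 1 \<phi> V W a E h x"
      and E: "\<forall>c d. {c..d} \<subseteq> {T0..T} \<longrightarrow>
        (\<exists>C. \<forall>\<^sub>F h in at_right 0. \<forall>t\<in>{c..d}. L2_Linf_bound C (\<lambda>y. E h (t, y)))"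
      unfolding oscillatory_solution_def by (meson order_refl)
    \<comment> \<open>The remainder bound on compact time intervals is applied to a single
      instant.\<close>
    have "{T'..T'} \<subseteq> {T0..T}"
      using t by simp
    with E obtain C where "\<forall>\<^sub>F h in at_right 0. \<forall>t\<in>{T'..T'}. L2_Linf_bound C (\<lambda>y. E h (t, y))"
      by blast
    then have "\<forall>\<^sub>F h in at_right 0. L2_Linf_bound C (\<lambda>y. E h (T', y))"
      by simp
    then show ?thesis
      using \<open>t1 > T0\<close> a by blast
  qed
  obtain t1 a1 E1 C1 where 1: "t1 > T0" "amplitudes q1 T0 t1 T \<phi> \<psi> V W 1 0 a1"
    "\<forall>\<^sub>F h in at_right 0. \<forall>x\<in>slab T0 T. of_real (u1 \<phi> \<psi> V W 1 0 h x) = expansion 1 \<phi> V W a1 E1 h x"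
    "\<forall>\<^sub>F h in at_right 0. L2_Linf_bound C1 (\<lambda>y. E1 h (T', y))"
    using expand[OF fam1] by blast
  obtain t2 a2 E2 C2 where 2: "t2 > T0" "amplitudes q2 T0 t2 T \<phi> \<psi> V W 1 0 a2"
    "\<forall>\<^sub>F h in at_right 0. \<forall>x\<in>slab T0 T. of_real (u2 \<phi> \<psi> V W 1 0 h x) = expansion 1 \<phi> V W a2 E2 h x"
    "\<forall>\<^sub>F h in at_right 0. L2_Linf_bound C2 (\<lambda>y. E2 h (T', y))"
    using expand[OF fam2] by blast
  have T'_in: "(T', z) \<in> slab T0 T" for z :: "real ^ 'n"
    using t by (simp add: slab_def)
  have "\<forall>\<^sub>F h in at_right 0. \<forall>y. u1 \<phi> \<psi> V W 1 0 h (T', y) = u2 \<phi> \<psi> V W 1 0 h (T', y)"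
    using data dirs \<phi>(1) \<psi>(1) by (simp add: same_data_at_def)
  then have eq: "\<forall>\<^sub>F h in at_right 0. \<forall>z.
      expansion 1 \<phi> V W a1 E1 h (T', z) = expansion 1 \<phi> V W a2 E2 h (T', z)"
    using 1(3) 2(3) by eventually_elim (metis T'_in)
  have slice: "continuous_on UNIV (\<lambda>z. a m p (T', z))"
    if "amplitudes q T0 t0 T \<phi> \<psi> V W 1 0 a" for q t0 a m p
  proof -
    have "Ck_on 0 (slab T0 T) (a m p)"
      using that by (auto simp: amplitudes_def smooth_on_def simp del: Ck_on.simps)
    then have "continuous_on (slab T0 T) (a m p)"
      by simp
    then show ?thesis
      by (rule continuous_on_compose2) (auto intro!: continuous_intros T'_in)
  qed
  have "mink (T', y - T' *\<^sub>R \<omega>) W = \<omega> \<bullet> y"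
    using \<omega>' by (simp add: mink_def W_def inner_vec_def algebra_simps sum_subtractf sum_distrib_left[symmetric])
  then have "a1 1 0 (T', y - T' *\<^sub>R \<omega>) = a2 1 0 (T', y - T' *\<^sub>R \<omega>)"
    using leading_amplitude_determined[OF slice[OF 1(2)] slice[OF 2(2)] eq 1(4) 2(4)] phase by simp
  then show ?thesis
    using leading_amplitude_on_ray[OF 1(2)[unfolded V_def W_def] q1 \<phi>(2,3) \<omega>' 1(1), of T' y]
      leading_amplitude_on_ray[OF 2(2)[unfolded V_def W_def] q2 \<phi>(2,3) \<omega>' 2(1), of T' y] t \<psi>(2)
    by simp
qed

text \<open>The difference of the two nonlinearities along the ray has zero integral against every
  admissible step profile, which is the premise of \<open>step_concentrates\<close>.\<close>

lemma nonlinearity_eq_on_ray: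
  fixes q1 q2 :: "'n::finite spacetime \<Rightarrow> real \<Rightarrow> real" and u1 u2 :: "'n solution_family"
    and \<omega> x' :: "real ^ 'n"
  assumes fam: "oscillatory_family q1 T0 T u1" "oscillatory_family q2 T0 T u2"
    and data: "same_data_at T' u1 u2"
    and q1: "continuous_on UNIV (\<lambda>(x, s). q1 x s)" and q2: "continuous_on UNIV (\<lambda>(x, s). q2 x s)"
    and \<omega>: "norm \<omega> = 1" and b: "T0 < b" "b \<le> T'" and T: "T' < T"
    and phase: "\<omega> \<bullet> x' + b \<noteq> 0"
  shows "q1 (b, x') v = q2 (b, x') v"
proof -
  obtain \<eta> \<eta>' :: "real \<Rightarrow> real"
    where \<eta>: "\<And>x. (\<eta> has_real_derivative \<eta>' x) (at x)" "\<And>k. Ck_on k UNIV \<eta>"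
      "continuous_on UNIV \<eta>'" "\<And>x. \<eta>' x \<ge> 0"
      "\<And>x. x \<le> 0 \<Longrightarrow> \<eta> x = 0" "\<And>x. x \<ge> 1 \<Longrightarrow> \<eta> x = 1"
      "\<And>x. x \<le> 0 \<or> x \<ge> 1 \<Longrightarrow> \<eta>' x = 0"
    using smooth_step_exists by blast
  \<comment> \<open>The label of the ray that passes through x' at time b.\<close>
  define y where "y = x' + b *\<^sub>R \<omega>"
  define \<xi> where "\<xi> = \<omega> \<bullet> y"
  have \<xi>: "\<xi> \<noteq> 0"
    using phase \<omega> by (simp add: \<xi>_def y_def inner_add_right power2_norm_eq_inner[symmetric])
  define G where "G s v = q1 (s, y - s *\<^sub>R \<omega>) v - q2 (s, y - s *\<^sub>R \<omega>) v" for s v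
  note cont = continuous_on_compose_curried[OF q1] continuous_on_compose_curried[OF q2]
  have cont\<eta>': "continuous_on S (\<lambda>s. \<eta>' (f s))" if "continuous_on S f" for S :: "real set" and f
    using that \<eta>(3) by (auto intro: continuous_on_compose2[of UNIV])
  have "G b v = 0"
  proof (rule step_concentrates[where G = G, OF \<eta>(1,3-7) _ b])
    show "continuous_on UNIV (\<lambda>(s, v). G s v)"
      unfolding G_def split_def by (intro continuous_intros cont)
    fix \<epsilon> u :: real assume \<epsilon>: "0 < \<epsilon>" "\<epsilon> < b - T0"
    \<comment> \<open>The values of \<langle>x, V\<rangle> on the ray at times b and T0. It
      decreases at speed 2, so a transition of length \<epsilon> in time has length 2 \<epsilon> in
      z.\<close>
    define z0 z1 where "z0 = \<xi> - 2 * b" and "z1 = \<xi> - 2 * T0"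
    define \<phi> where "\<phi> z = u * (\<eta> ((z - z0) / (2 * \<epsilon>)) - \<eta> (z - z1))" for z
    define \<phi>' where "\<phi>' z = u * (\<eta>' ((z - z0) / (2 * \<epsilon>)) / (2 * \<epsilon>) - \<eta>' (z - z1))" for z
    \<comment> \<open>Along the ray \<open>\<phi>\<close> is a step at time \<open>b\<close>. The term \<open>\<eta> (z - z1)\<close> only makes the
      support compact: it vanishes along the ray from time \<open>T0\<close> on.\<close>
    have d\<phi>: "(\<phi> has_real_derivative \<phi>' z) (at z)" for z
    proof -
      have shift: "((\<lambda>z. \<eta> (z - z1)) has_real_derivative \<eta>' (z - z1)) (at z)"
        using \<eta>(1)[of "z + - z1"] unfolding DERIV_shift by simp
      have scale: "((\<lambda>z. \<eta> ((z - z0) / (2 * \<epsilon>))) has_real_derivative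
          \<eta>' ((z - z0) / (2 * \<epsilon>)) / (2 * \<epsilon>)) (at z)"
        by (rule DERIV_cong, (rule derivative_eq_intros DERIV_chain2[OF \<eta>(1)] refl)+)
          (use \<epsilon> in auto)
      show ?thesis
        unfolding \<phi>_def \<phi>'_def by (rule DERIV_cmult[OF DERIV_diff[OF scale shift]])
    qed
    then have deriv: "deriv \<phi> = \<phi>'"
      by (auto intro: DERIV_imp_deriv)
    have c\<phi>: "continuous_on UNIV \<phi>"
      by (intro continuous_at_imp_continuous_on ballI DERIV_isCont[OF d\<phi>])
    have c\<phi>': "continuous_on UNIV \<phi>'"
      unfolding \<phi>'_def by (intro continuous_intros cont\<eta>'; use \<epsilon> in simp)
    have "test_function \<phi>"
    proof (rule test_functionI[where M = "\<bar>z0\<bar> + \<bar>z1\<bar> + 1"])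
      fix k
      have "Ck_on k UNIV (\<lambda>z. u * (\<eta> (1 / (2 * \<epsilon>) * z + - z0 / (2 * \<epsilon>)) + - 1 * \<eta> (1 * z + - z1)))"
        by (intro Ck_on_cmult Ck_on_add Ck_on_affine \<eta>(2))
      then show "Ck_on k UNIV \<phi>"
        by (simp add: \<phi>_def[abs_def] diff_divide_distrib)
    next
      fix z assume nz: "\<phi> z \<noteq> 0"
      have "z0 \<le> z1"
        using b by (simp add: z0_def z1_def)
      have "z \<ge> z0"
      proof (rule ccontr)
        assume "\<not> z \<ge> z0"
        then have "\<eta> ((z - z0) / (2 * \<epsilon>)) = 0" "\<eta> (z - z1) = 0"
          using \<epsilon> \<open>z0 \<le> z1\<close> by (auto intro!: \<eta>(5) simp: divide_nonpos_pos)
        then show False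
          using nz by (simp add: \<phi>_def)
      qed
      moreover have "z \<le> z1 + 1"
      proof (rule ccontr)
        assume "\<not> z \<le> z1 + 1"
        \<comment> \<open>Because z1 - z0 = 2 (b - T0) exceeds 2 \<epsilon>, the first step is
          complete before the second begins.\<close>
        then have "z - z0 \<ge> 2 * \<epsilon>" "z - z1 \<ge> 1"
          using \<epsilon> by (simp_all add: z0_def z1_def)
        then have "\<eta> ((z - z0) / (2 * \<epsilon>)) = 1" "\<eta> (z - z1) = 1"
          using \<epsilon> by (auto intro!: \<eta>(6))
        then show False
          using nz by (simp add: \<phi>_def)
      qed
      ultimately show "\<bar>z\<bar> \<le> \<bar>z0\<bar> + \<bar>z1\<bar> + 1"
        by linarith
    qed
    from ray_integrals_eq[OF fam data q1 q2 this c\<phi> _ \<omega> _ T, of y] b \<xi> c\<phi>'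
    have int: "integral {T0..T'} (\<lambda>s. q1 (s, y - s *\<^sub>R \<omega>) (\<phi> (\<xi> - 2 * s)) * \<phi>' (\<xi> - 2 * s)) =
        integral {T0..T'} (\<lambda>s. q2 (s, y - s *\<^sub>R \<omega>) (\<phi> (\<xi> - 2 * s)) * \<phi>' (\<xi> - 2 * s))"
      by (simp add: deriv \<xi>_def)
    have c1: "continuous_on {T0..T'} (\<lambda>s. \<phi> (\<xi> - 2 * s))" "continuous_on {T0..T'} (\<lambda>s. \<phi>' (\<xi> - 2 * s))"
      by (auto intro!: continuous_intros continuous_on_compose2[OF c\<phi>] continuous_on_compose2[OF c\<phi>'])
    have "integral {T0..T'} (\<lambda>s. G s (\<phi> (\<xi> - 2 * s)) * \<phi>' (\<xi> - 2 * s)) = 0"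
      unfolding G_def left_diff_distrib
      by (subst integral_diff) (auto intro!: integrable_continuous_real continuous_intros cont c1 simp: int)
    \<comment> \<open>The factor 2 makes up for the speed of \<langle>x, V\<rangle>: \<phi>' carries
      1/(2 \<epsilon>), the premise to be shown has 1/\<epsilon>.\<close>
    then have "integral {T0..T'} (\<lambda>s. 2 * (G s (\<phi> (\<xi> - 2 * s)) * \<phi>' (\<xi> - 2 * s))) = 0"
      by simp
    moreover have "integral {T0..T'} (\<lambda>s. 2 * (G s (\<phi> (\<xi> - 2 * s)) * \<phi>' (\<xi> - 2 * s))) =
        integral {T0..T'} (\<lambda>s. G s (u * \<eta> ((b - s) / \<epsilon>)) * (u * \<eta>' ((b - s) / \<epsilon>) / \<epsilon>))"
    proof (rule integral_cong)
      fix s assume "s \<in> {T0..T'}"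
      then have "\<eta> (\<xi> - 2 * s - z1) = 0" "\<eta>' (\<xi> - 2 * s - z1) = 0"
        by (auto intro!: \<eta>(5,7) simp: z1_def)
      moreover have "(\<xi> - 2 * s - z0) / (2 * \<epsilon>) = (b - s) / \<epsilon>"
        using \<epsilon> by (simp add: z0_def field_simps)
      ultimately show "2 * (G s (\<phi> (\<xi> - 2 * s)) * \<phi>' (\<xi> - 2 * s)) =
          G s (u * \<eta> ((b - s) / \<epsilon>)) * (u * \<eta>' ((b - s) / \<epsilon>) / \<epsilon>)"
        by (simp add: \<phi>_def \<phi>'_def)
    qed
    ultimately show "integral {T0..T'} (\<lambda>s. G s (u * \<eta> ((b - s) / \<epsilon>)) * (u * \<eta>' ((b - s) / \<epsilon>) / \<epsilon>)) = 0"
      by simp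
  qed
  then show ?thesis
    by (simp add: G_def y_def)
qed

theorem theorem1p2:
  fixes R :: real
  assumes "R > 0"
  shows "\<exists>Tmin. \<forall>T0 T' T.
    \<forall>(q1 :: 'n::finite spacetime \<Rightarrow> real \<Rightarrow> real) (q2 :: 'n spacetime \<Rightarrow> real \<Rightarrow> real)
     (u1 :: 'n solution_family) (u2 :: 'n solution_family).
      T0 < - R \<longrightarrow> Tmin \<le> T' \<longrightarrow> T' < T \<longrightarrow>
      admissible R q1 \<longrightarrow> admissible R q2 \<longrightarrow>
      oscillatory_family q1 T0 T u1 \<longrightarrow> oscillatory_family q2 T0 T u2 \<longrightarrow>
      same_data_at T' u1 u2 \<longrightarrow> q1 = q2"
\<comment> \<open>R serves as \<open>Tmin\<close>: points of the support have times in [-R, R], so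
  T0 < b and b \<le> T' hold there.\<close>
proof (intro exI[of _ R] allI impI ext)
  fix T0 T' T :: real and q1 q2 :: "'n spacetime \<Rightarrow> real \<Rightarrow> real"
    and u1 u2 :: "'n solution_family" and x :: "'n spacetime" and v :: real
  assume T: "T0 < - R" "R \<le> T'" "T' < T"
    and adm: "admissible R q1" "admissible R q2"
    and fam: "oscillatory_family q1 T0 T u1" "oscillatory_family q2 T0 T u2"
    and data: "same_data_at T' u1 u2"
  have cont: "continuous_on UNIV (\<lambda>(x, s). q x s)" if "admissible R q"
    for q :: "'n spacetime \<Rightarrow> real \<Rightarrow> real"
    using that by (auto simp: admissible_def smooth_on_def dest: spec[of _ 0])
  show "q1 x v = q2 x v"
  proof (cases "norm x \<le> R")
    case False
    then show ?thesis
      using adm by (metis admissible_def)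
  next
    case True
    obtain b x' where x: "x = (b, x')" by force
    have "\<bar>b\<bar> \<le> R"
      using True norm_fst_le[of b x'] by (simp add: x)
    then have b: "T0 < b" "b \<le> T'"
      using T by auto
    \<comment> \<open>One arbitrary coordinate direction is enough, since every point lies on a ray
      in that direction.\<close>
    define \<omega> :: "real ^ 'n" where "\<omega> = axis undefined 1"
    have \<omega>: "norm \<omega> = 1"
      by (simp add: \<omega>_def norm_axis_1)
    note eq = nonlinearity_eq_on_ray[OF fam data cont[OF adm(1)] cont[OF adm(2)] \<omega> b T(3)]
    show ?thesis
    proof (cases "\<omega> \<bullet> x' + b = 0")
      case False
      then show ?thesis
        using eq x by simp
    next
      case True
      \<comment> \<open>Moving along \<omega> by 1/(k + 1) makes the phase equal to 1/(k + 1), hence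
        nonzero; continuity of both nonlinearities then carries the equality to the limit
        point.\<close>
      define X where "X k = x' + (1 / real (Suc k)) *\<^sub>R \<omega>" for k
      have "\<omega> \<bullet> X k + b = 1 / real (Suc k)" for k
        using True \<omega> by (simp add: X_def inner_add_right power2_norm_eq_inner[symmetric])
      then have eqX: "q1 (b, X k) v = q2 (b, X k) v" for k
        by (intro eq) simp
      have "(\<lambda>k. 1 / real (Suc k)) \<longlonglongrightarrow> 0"
        using LIMSEQ_inverse_real_of_nat by (simp add: inverse_eq_divide)
      then have "X \<longlonglongrightarrow> x' + 0 *\<^sub>R \<omega>"
        unfolding X_def by (intro tendsto_intros)
      then have X: "(\<lambda>k. ((b, X k), v)) \<longlonglongrightarrow> ((b, x'), v)"
        by (auto intro!: tendsto_intros)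
      have lim: "(\<lambda>k. q (b, X k) v) \<longlonglongrightarrow> q (b, x') v"
        if "admissible R q" for q :: "'n spacetime \<Rightarrow> real \<Rightarrow> real"
        using continuous_on_tendsto_compose[OF cont[OF that] X] by simp
      show ?thesis
        using LIMSEQ_unique[OF lim[OF adm(1)]] lim[OF adm(2)] by (simp add: x eqX)
    qed
  qed
qed

end
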